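(* Let $\mathcal{X}$ be a 3-product space with norm $\|\cdot\|$ and 3-product $\langle\cdot,\cdot,\cdot\rangle$. Let $A:\mathcal{D}(A)\subseteq\mathcal{X}\to\mathcal{X}$, $B:\mathcal{D}(B)\subseteq\mathcal{X}\to\mathcal{X}$ and $C:\mathcal{D}(C)\subseteq\mathcal{X}\to\mathcal{X}$ be possibly unbounded 3-self-adjoint operators. Then for all $$x\in\mathcal{D}(ABC)\cap\mathcal{D}(ACB)\cap\mathcal{D}(BAC)\cap\mathcal{D}(BCA)\cap\mathcal{D}(CAB)\cap\mathcal{D}(CBA)$$ with $\langle x,x,x\rangle=1$, we have $$\frac{1}{27}\bigl(\Delta_x(3,A)+\Delta_x(3,B)+\Delta_x(3,C)\bigr)^3\ \geq\ \Delta_x(3,A)\,\Delta_x(3,B)\,\Delta_x(3,C)$$ and $$\Delta_x(3,A)\,\Delta_x(3,B)\,\Delta_x(3,C)\ \geq\ \bigl|\langle (ABC-\langle Ax,x,x\rangle BC-\langle Bx,x,x\rangle AC-\langle Cx,x,x\rangle AB)x,\,x,\,x\rangle+2\langle Ax,x,x\rangle\langle Bx,x,x\rangle\langle Cx,x,x\rangle\bigr|.$$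
   Context: A 3-product space is a real Banach space $\mathcal{X}$ with norm $\|\cdot\|$ together with a map $\langle\cdot,\cdot,\cdot\rangle:\mathcal{X}\times\mathcal{X}\times\mathcal{X}\to\mathbb{R}$, called a 3-product, satisfying: (i) $\langle x,y,z\rangle$ is invariant under every permutation of its three arguments, for all $x,y,z\in\mathcal{X}$; (ii) $\langle\alpha x,y,z\rangle=\alpha\langle x,y,z\rangle$ for all $x,y,z\in\mathcal{X}$ and $\alpha\in\mathbb{R}$; (iii) $\langle x+w,y,z\rangle=\langle x,y,z\rangle+\langle w,y,z\rangle$ for all $x,y,z,w\in\mathcal{X}$; (iv) $|\langle x,y,z\rangle|\leq\|x\|\,\|y\|\,\|z\|$ for all $x,y,z\in\mathcal{X}$. A possibly unbounded linear operator $A:\mathcal{D}(A)\subseteq\mathcal{X}\to\mathcal{X}$, defined on a linear subspace $\mathcal{D}(A)$ of $\mathcal{X}$, is called 3-self-adjoint if $\langle Ax,y,z\rangle=\langle x,Ay,z\rangle=\langle x,y,Az\rangle$ for all $x,y,z\in\mathcal{D}(A)$. Products of operators are compositions with their natural domains, e.g. $\mathcal{D}(ABC)=\{x\in\mathcal{D}(C): Cx\in\mathcal{D}(B),\ BCx\in\mathcal{D}(A)\}$, and similarly for the other orderings and for products of two operators. For a 3-self-adjoint operator $A$ and $x\in\mathcal{D}(A)$ with $\langle x,x,x\rangle=1$, the 3-uncertainty of $A$ at $x$ is $\Delta_x(3,A):=\|Ax-\langle Ax,x,x\rangle x\|$. *)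

theory Defs
  imports "HOL-Analysis.Analysis"
begin

locale three_product_space =
  fixes tp :: "'a::banach \<Rightarrow> 'a \<Rightarrow> 'a \<Rightarrow> real"
  assumes tp_permute:
      "tp x y z = tp x z y" "tp x y z = tp y x z" "tp x y z = tp y z x"
      "tp x y z = tp z x y" "tp x y z = tp z y x"
    and tp_scale: "tp (\<alpha> *\<^sub>R x) y z = \<alpha> * tp x y z"
    and tp_add: "tp (x + w) y z = tp x y z + tp w y z"
    and tp_bound: "\<bar>tp x y z\<bar> \<le> norm x * norm y * norm z"

text \<open>
  A possibly unbounded operator is a partial map \<open>A\<close>; its domain is \<open>dom A\<close>.
  The library's composition \<open>A \<circ>\<^sub>m B\<close> of partial maps is the product of operators with its
  natural domain: see \<open>dom_op_comp\<close> and \<open>dom_op_comp3\<close> below.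
\<close>

type_synonym 'a operator = "'a \<rightharpoonup> 'a"

text \<open>The value \<open>A \<cdot> x\<close> is meaningful only for \<open>x \<in> dom A\<close>.\<close>

definition op_app :: "'a operator \<Rightarrow> 'a \<Rightarrow> 'a" (infixl "\<cdot>" 90)
  where "A \<cdot> x = the (A x)"

definition op_minus :: "'a::real_vector operator \<Rightarrow> 'a operator \<Rightarrow> 'a operator" (infixl "\<ominus>" 65)
  where "A \<ominus> B = (\<lambda>x. if x \<in> dom A \<inter> dom B then Some (A \<cdot> x - B \<cdot> x) else None)"

definition op_scale :: "real \<Rightarrow> 'a::real_vector operator \<Rightarrow> 'a operator" (infixr "\<odot>" 75)
  where "c \<odot> A = (\<lambda>x. if x \<in> dom A then Some (c *\<^sub>R (A \<cdot> x)) else None)"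

definition linear_operator :: "'a::real_vector operator \<Rightarrow> bool"
  where "linear_operator A \<longleftrightarrow> subspace (dom A) \<and>
    (\<forall>x\<in>dom A. \<forall>y\<in>dom A. A \<cdot> (x + y) = A \<cdot> x + A \<cdot> y) \<and>
    (\<forall>c. \<forall>x\<in>dom A. A \<cdot> (c *\<^sub>R x) = c *\<^sub>R (A \<cdot> x))"

definition three_self_adjoint ::
    "('a::banach \<Rightarrow> 'a \<Rightarrow> 'a \<Rightarrow> real) \<Rightarrow> 'a operator \<Rightarrow> bool"
  where "three_self_adjoint tp A \<longleftrightarrow> linear_operator A \<and>
    (\<forall>x\<in>dom A. \<forall>y\<in>dom A. \<forall>z\<in>dom A.
      tp (A \<cdot> x) y z = tp x (A \<cdot> y) z \<and> tp x (A \<cdot> y) z = tp x y (A \<cdot> z))"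

definition three_uncertainty ::
    "('a::banach \<Rightarrow> 'a \<Rightarrow> 'a \<Rightarrow> real) \<Rightarrow> 'a operator \<Rightarrow> 'a \<Rightarrow> real"
  where "three_uncertainty tp A x = norm (A \<cdot> x - tp (A \<cdot> x) x x *\<^sub>R x)"

lemma dom_op_comp: "dom (A \<circ>\<^sub>m B) = {x \<in> dom B. B \<cdot> x \<in> dom A}"
  by (auto simp: map_comp_def op_app_def dom_def split: option.splits)

lemma op_app_comp: "x \<in> dom B \<Longrightarrow> (A \<circ>\<^sub>m B) \<cdot> x = A \<cdot> (B \<cdot> x)"
  by (auto simp: map_comp_def op_app_def)

lemma dom_op_comp3:
  "dom (A \<circ>\<^sub>m B \<circ>\<^sub>m C) = {x \<in> dom C. C \<cdot> x \<in> dom B \<and> B \<cdot> (C \<cdot> x) \<in> dom A}"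
  by (auto simp: dom_op_comp)

lemma dom_op_minus: "dom (A \<ominus> B) = dom A \<inter> dom B"
  by (auto simp: op_minus_def split: if_splits)

lemma op_app_minus: "x \<in> dom A \<Longrightarrow> x \<in> dom B \<Longrightarrow> (A \<ominus> B) \<cdot> x = A \<cdot> x - B \<cdot> x"
  by (simp add: op_minus_def op_app_def)

lemma dom_op_scale: "dom (c \<odot> A) = dom A"
  by (auto simp: op_scale_def split: if_splits)

lemma op_app_scale: "x \<in> dom A \<Longrightarrow> (c \<odot> A) \<cdot> x = c *\<^sub>R (A \<cdot> x)"
  by (simp add: op_scale_def op_app_def)

end

theory Submission
  imports Defs
begin

text \<open>
  The quantity inside the absolute value is \<open>tp ((A - a)x) ((B - b)x) ((C - c)x)\<close> with
  \<open>a = tp (Ax) x x\<close>, \<open>b = tp (Bx) x x\<close>, \<open>c = tp (Cx) x x\<close>: expand by trilinearity and move the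
  operators back to the first slot by self-adjointness. The bound on the 3-product then gives the
  second inequality; the first is the AM-GM inequality.
\<close>

lemma arith_geo_mean3:
  fixes a b c :: real
  assumes "a \<ge> 0" "b \<ge> 0" "c \<ge> 0"
  shows "a * b * c \<le> 1 / 27 * (a + b + c) ^ 3"
proof -
  \<comment> \<open>Sum-of-squares certificate: the first summand is a^3 + b^3 + c^3 - 3abc
    factored, the second collects the mixed terms a^2 b. Every square carries a nonnegative
    coefficient.\<close>
  have "(a + b + c) ^ 3 - 27 * (a * b * c) =
      (a + b + c) / 2 * ((a - b)\<^sup>2 + (b - c)\<^sup>2 + (c - a)\<^sup>2)
      + 3 * (a * (b - c)\<^sup>2 + b * (c - a)\<^sup>2 + c * (a - b)\<^sup>2)"
    by (simp add: power2_eq_square power3_eq_cube field_simps)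
  also have "\<dots> \<ge> 0"
    using assms by (intro add_nonneg_nonneg mult_nonneg_nonneg) auto
  finally show ?thesis by simp
qed

context three_product_space
begin

lemma tp_minus_left: "tp (x - w) y z = tp x y z - tp w y z"
  using tp_add[of x "- 1 *\<^sub>R w" y z] tp_scale[of "- 1" w y z] by simp

lemma tp_minus_middle: "tp x (y - w) z = tp x y z - tp x w z"
  using tp_minus_left[of y w x z] by (simp add: tp_permute(2)[of x])

lemma tp_minus_right: "tp x y (z - w) = tp x y z - tp x y w"
  using tp_minus_left[of z w y x] by (simp add: tp_permute(5)[of x])

lemma tp_scale_middle: "tp x (\<alpha> *\<^sub>R y) z = \<alpha> * tp x y z"
  using tp_scale[of \<alpha> y x z] by (simp add: tp_permute(2)[of x])

lemma tp_scale_right: "tp x y (\<alpha> *\<^sub>R z) = \<alpha> * tp x y z"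
  using tp_scale[of \<alpha> z y x] by (simp add: tp_permute(5)[of x])

text \<open>Of the eight terms of the expansion, the three with \<open>x\<close> in two slots each
  give \<open>+\<close> the product of the three means, and the one with \<open>x\<close> in all
  slots gives \<open>-\<close> it by normalization; hence the factor 2 = 3 - 1.\<close>

lemma tp_shifted_product:
  assumes "tp x x x = 1"
  shows "tp (u - tp u x x *\<^sub>R x) (v - tp v x x *\<^sub>R x) (w - tp w x x *\<^sub>R x) =
    tp u v w - tp u x x * tp v w x - tp v x x * tp u w x - tp w x x * tp u v x
    + 2 * tp u x x * tp v x x * tp w x x"
proof -
  have "tp x v w = tp v w x" "tp u x w = tp u w x"
       "tp x v x = tp v x x" "tp x x w = tp w x x"
    by (rule tp_permute)+
  then show ?thesis
    using assms
    by (simp add: tp_minus_left tp_minus_middle tp_minus_right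
        tp_scale tp_scale_middle tp_scale_right algebra_simps)
qed

text \<open>Self-adjointness carries \<open>A\<close> to the second slot, then symmetry exchanges
  the first two slots. With \<open>y\<close> an image such as \<open>B \<cdot> x\<close>, this
  strips the outer operator off a product.\<close>

lemma three_self_adjoint_swap:
  assumes "three_self_adjoint tp A" "x \<in> dom A" "y \<in> dom A"
  shows "tp (A \<cdot> y) x x = tp (A \<cdot> x) y x"
  using assms tp_permute(2)[of y "A \<cdot> x" x] unfolding three_self_adjoint_def by metis

end

theorem theorem2p7:
  fixes tp :: "'a::banach \<Rightarrow> 'a \<Rightarrow> 'a \<Rightarrow> real"
    and A B C :: "'a operator" and x :: 'a
  assumes "three_product_space tp"
    and "three_self_adjoint tp A" and "three_self_adjoint tp B" and "three_self_adjoint tp C"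
    and "x \<in> dom (A \<circ>\<^sub>m B \<circ>\<^sub>m C) \<inter> dom (A \<circ>\<^sub>m C \<circ>\<^sub>m B) \<inter> dom (B \<circ>\<^sub>m A \<circ>\<^sub>m C) \<inter>
              dom (B \<circ>\<^sub>m C \<circ>\<^sub>m A) \<inter> dom (C \<circ>\<^sub>m A \<circ>\<^sub>m B) \<inter> dom (C \<circ>\<^sub>m B \<circ>\<^sub>m A)"
    and "tp x x x = 1"
  shows "1 / 27 * (three_uncertainty tp A x + three_uncertainty tp B x + three_uncertainty tp C x) ^ 3
           \<ge> three_uncertainty tp A x * three_uncertainty tp B x * three_uncertainty tp C x
       \<and> three_uncertainty tp A x * three_uncertainty tp B x * three_uncertainty tp C x
           \<ge> \<bar>tp (((A \<circ>\<^sub>m B \<circ>\<^sub>m C)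
                   \<ominus> tp (A \<cdot> x) x x \<odot> (B \<circ>\<^sub>m C)
                   \<ominus> tp (B \<cdot> x) x x \<odot> (A \<circ>\<^sub>m C)
                   \<ominus> tp (C \<cdot> x) x x \<odot> (A \<circ>\<^sub>m B)) \<cdot> x) x x
               + 2 * tp (A \<cdot> x) x x * tp (B \<cdot> x) x x * tp (C \<cdot> x) x x\<bar>"
proof -
  interpret three_product_space tp by fact
  note dom_simps = dom_op_comp op_app_comp dom_op_minus op_app_minus dom_op_scale op_app_scale
  \<comment> \<open>Self-adjointness applies only inside the domain, so images of \<open>x\<close>
    must lie there too. The orderings other than ABC matter here:
    \<open>A \<cdot> x \<in> dom B\<close> comes from CBA, for instance.\<close>
  have D: "x \<in> dom A" "x \<in> dom B" "x \<in> dom C"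
      "A \<cdot> x \<in> dom B" "B \<cdot> x \<in> dom A" "C \<cdot> x \<in> dom A" "C \<cdot> x \<in> dom B"
      "B \<cdot> (C \<cdot> x) \<in> dom A"
    using assms(5) unfolding Int_iff dom_op_comp3 by blast+
  let ?a = "tp (A \<cdot> x) x x" and ?b = "tp (B \<cdot> x) x x" and ?c = "tp (C \<cdot> x) x x"
  let ?T = "(A \<circ>\<^sub>m B \<circ>\<^sub>m C) \<ominus> ?a \<odot> (B \<circ>\<^sub>m C) \<ominus> ?b \<odot> (A \<circ>\<^sub>m C) \<ominus> ?c \<odot> (A \<circ>\<^sub>m B)"
  have T: "?T \<cdot> x = A \<cdot> (B \<cdot> (C \<cdot> x)) - ?a *\<^sub>R (B \<cdot> (C \<cdot> x))
      - ?b *\<^sub>R (A \<cdot> (C \<cdot> x)) - ?c *\<^sub>R (A \<cdot> (B \<cdot> x))"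
    using D by (simp add: dom_simps)
  have "tp (A \<cdot> (B \<cdot> (C \<cdot> x))) x x = tp (B \<cdot> (C \<cdot> x)) (A \<cdot> x) x"
    using three_self_adjoint_swap[OF assms(2)] D tp_permute(2) by metis
  \<comment> \<open>\<open>B\<close> passes from the first slot to the third, across
    \<open>A \<cdot> x\<close>; this is where \<open>A \<cdot> x \<in> dom B\<close> is
    needed.\<close>
  also have "\<dots> = tp (C \<cdot> x) (A \<cdot> x) (B \<cdot> x)"
    using assms(3) D unfolding three_self_adjoint_def by metis
  also have "\<dots> = tp (A \<cdot> x) (B \<cdot> x) (C \<cdot> x)" by (rule tp_permute)
  finally have "tp (A \<cdot> (B \<cdot> (C \<cdot> x))) x x = tp (A \<cdot> x) (B \<cdot> x) (C \<cdot> x)" .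
  moreover have "tp (B \<cdot> (C \<cdot> x)) x x = tp (B \<cdot> x) (C \<cdot> x) x"
      "tp (A \<cdot> (C \<cdot> x)) x x = tp (A \<cdot> x) (C \<cdot> x) x"
      "tp (A \<cdot> (B \<cdot> x)) x x = tp (A \<cdot> x) (B \<cdot> x) x"
    using three_self_adjoint_swap assms(2,3) D by blast+
  ultimately have "tp (?T \<cdot> x) x x + 2 * ?a * ?b * ?c =
      tp (A \<cdot> x - ?a *\<^sub>R x) (B \<cdot> x - ?b *\<^sub>R x) (C \<cdot> x - ?c *\<^sub>R x)"
    unfolding T tp_shifted_product[OF assms(6)] by (simp add: tp_minus_left tp_scale)
  then have "\<bar>tp (?T \<cdot> x) x x + 2 * ?a * ?b * ?c\<bar> \<le>
      three_uncertainty tp A x * three_uncertainty tp B x * three_uncertainty tp C x"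
    \<comment> \<open>The norms of the three shifted vectors are exactly the uncertainties.\<close>
    using tp_bound unfolding three_uncertainty_def by simp
  moreover have "three_uncertainty tp A x * three_uncertainty tp B x * three_uncertainty tp C x \<le>
      1 / 27 * (three_uncertainty tp A x + three_uncertainty tp B x + three_uncertainty tp C x) ^ 3"
    by (rule arith_geo_mean3) (simp_all add: three_uncertainty_def)
  ultimately show ?thesis by blast
qed

end
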